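(* For an arbitrary convex domain $G\subsetneq\mathbb{R}^n$ and all $x,y\in G$, $$w_G(x,y)\leq s_G(x,y)\leq\sqrt{2}\,w_G(x,y).$$
   Context: A domain is a non-empty open connected set. For a convex domain $G\subsetneq\mathbb{R}^n$ and $x\in G$, let $d_G(x)=\inf\{|x-z| : z\in\partial G\}$, $S^{n-1}(x,r)=\{y\in\mathbb{R}^n : |x-y|=r\}$, and let $\widetilde{X}$ be the non-empty set $$\widetilde{X}=\{\widetilde{x}\in S^{n-1}(x,2d_G(x)) : (x+\widetilde{x})/2\in\partial G\};$$ for $y\in G$ the set $\widetilde{Y}$ is defined in the same way from $y$. The function $w_G:G\times G\to[0,1]$ is $$w_G(x,y)=\frac{|x-y|}{\min\{\inf_{\widetilde{y}\in\widetilde{Y}}|x-\widetilde{y}|,\ \inf_{\widetilde{x}\in\widetilde{X}}|y-\widetilde{x}|\}}.$$ The triangular ratio metric is $$s_G(x,y)=\frac{|x-y|}{\inf_{z\in\partial G}(|x-z|+|z-y|)}.$$ *)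

theory Defs
  imports "HOL-Analysis.Analysis"
begin

definition domain :: "'a::euclidean_space set \<Rightarrow> bool" where
  "domain G \<longleftrightarrow> G \<noteq> {} \<and> open G \<and> connected G"

definition bdist :: "'a::euclidean_space set \<Rightarrow> 'a \<Rightarrow> real" where
  "bdist G x = infdist x (frontier G)"

text \<open>The set written \<open>X\<close> with a tilde in the literature: the points obtained by doubling
  the vector from \<open>x\<close> to a nearest boundary point. For \<open>x\<close> in a proper domain \<open>G\<close> it is non-empty,
  so the convention \<open>infdist y {} = 0\<close> plays no role in \<open>w_fun\<close> below.\<close>

definition tilde_set :: "'a::euclidean_space set \<Rightarrow> 'a \<Rightarrow> 'a set" where
  "tilde_set G x = {x' \<in> sphere x (2 * bdist G x). midpoint x x' \<in> frontier G}"

definition w_fun :: "'a::euclidean_space set \<Rightarrow> 'a \<Rightarrow> 'a \<Rightarrow> real" where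
  "w_fun G x y = dist x y / min (infdist x (tilde_set G y)) (infdist y (tilde_set G x))"

definition triangular_ratio_metric :: "'a::euclidean_space set \<Rightarrow> 'a \<Rightarrow> 'a \<Rightarrow> real" where
  "triangular_ratio_metric G x y = dist x y / (INF z\<in>frontier G. dist x z + dist z y)"

end

theory Submission
  imports Defs
begin

text \<open>Let \<open>S\<close> be the infimum of \<open>|x - z| + |z - y|\<close> over the boundary and \<open>M\<close> the denominator of
  \<open>w\<close>; the claim is \<open>S \<le> M \<le> sqrt 2 * S\<close>. The hyperplane through a nearest boundary point \<open>z\<close> of \<open>x\<close>
  orthogonal to \<open>x - z\<close> supports \<open>G\<close>, and reflecting \<open>x\<close> in it gives \<open>x'\<close>. The segment from \<open>y\<close> to
  \<open>x'\<close> meets the hyperplane in a point \<open>p\<close> outside \<open>G\<close> with \<open>|x - p| + |p - y| = |y - x'|\<close>, so \<open>S \<le> M\<close>.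
  Conversely, let \<open>d\<close> be the smaller of the two boundary distances and \<open>t = |x - y|\<close>. By convexity the
  boundary stays at distance \<open>d\<close> from the segment from \<open>x\<close> to \<open>y\<close>, which forces \<open>t^2 + 4 d^2 \<le> S^2\<close>,
  while \<open>M \<le> t + 2 d \<le> sqrt (2 (t^2 + 4 d^2))\<close>.\<close>

text \<open>A ball is connected, so leaving \<open>G\<close> would force it to meet the frontier at
  a distance from \<open>x\<close> below \<open>bdist G x\<close>.\<close>

lemma ball_bdist_subset:
  fixes G :: "'a::euclidean_space set"
  assumes "x \<in> G"
  shows "ball x (bdist G x) \<subseteq> G"
proof (rule ccontr)
  assume "\<not> ball x (bdist G x) \<subseteq> G"
  then obtain p where p: "p \<in> ball x (bdist G x)" "p \<notin> G" by blast
  have "x \<in> ball x (bdist G x)"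
    using p(1) by (metis centre_in_ball ball_eq_empty empty_iff not_le)
  then obtain q where "q \<in> ball x (bdist G x)" "q \<in> frontier G"
    using connected_Int_frontier[OF connected_ball, of x "bdist G x" G] p assms by blast
  then show False
    using infdist_le[of q "frontier G" x] by (auto simp: bdist_def)
qed

text \<open>If the product were negative, moving from \<open>z\<close> away from \<open>y\<close>
  would at first approach \<open>x\<close>, hence enter the ball inside \<open>G\<close>; then
  \<open>z\<close> would lie between two points of \<open>G\<close>, against convexity. Openness of
  \<open>G\<close> makes the inequality strict.\<close>

lemma nearest_frontier_point_supports:
  fixes G :: "'a::euclidean_space set"
  assumes "open G" "convex G" "x \<in> G" "z \<in> frontier G" "dist x z = bdist G x" "y \<in> G"
  shows "0 < (y - z) \<bullet> (x - z)"
proof -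
  have zG: "z \<notin> G"
    using assms by (simp add: frontier_def interior_open)
  have nonneg: "0 \<le> (y - z) \<bullet> (x - z)" if "y \<in> G" for y
  proof (rule ccontr)
    assume "\<not> ?thesis"
    \<comment> \<open>\<open>closer_point_lemma\<close> takes a target point, so the direction
      \<open>z - y\<close> is given by the reflection of \<open>y\<close> in
      \<open>z\<close>.\<close>
    then have "0 < (x - z) \<bullet> ((2 *\<^sub>R z - y) - z)"
      by (simp add: inner_commute inner_diff_left inner_diff_right algebra_simps)
    from closer_point_lemma[OF this] obtain u where
      u: "u > 0" "dist (z + u *\<^sub>R ((2 *\<^sub>R z - y) - z)) x < dist z x" by blast
    define q where "q = z + u *\<^sub>R (z - y)"
    have "(2 *\<^sub>R z - y) - z = z - y" by (simp add: scaleR_2)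
    then have "q \<in> ball x (bdist G x)"
      using u(2) assms(5) by (simp only: q_def mem_ball dist_commute)
    then have "q \<in> G" using ball_bdist_subset[OF \<open>x \<in> G\<close>] by blast
    have "z = (1 / (1 + u)) *\<^sub>R q + (u / (1 + u)) *\<^sub>R y"
    proof -
      have "(1 + u) *\<^sub>R z = q + u *\<^sub>R y" by (simp add: q_def algebra_simps)
      then have "(1 / (1 + u)) *\<^sub>R ((1 + u) *\<^sub>R z) = (1 / (1 + u)) *\<^sub>R (q + u *\<^sub>R y)" by simp
      then show ?thesis using u(1) by (simp add: scaleR_add_right)
    qed
    also have "\<dots> \<in> G"
      using \<open>convex G\<close> \<open>q \<in> G\<close> that u(1)
      by (intro convexD) (auto simp: add_divide_distrib[symmetric])
    finally show False using zG by simp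
  qed
  have "x \<noteq> z" using zG assms by auto
  obtain e where e: "e > 0" "ball y e \<subseteq> G"
    using assms open_contains_ball by blast
  \<comment> \<open>Moving \<open>y\<close> by \<open>e / 2\<close> against \<open>x - z\<close>
    stays in \<open>G\<close> and lowers the product by a positive amount, yet the product remains
    nonnegative.\<close>
  define y' where "y' = y - (e / (2 * norm (x - z))) *\<^sub>R (x - z)"
  have "y' \<in> ball y e" using e \<open>x \<noteq> z\<close> by (simp add: y'_def dist_norm)
  then have "0 \<le> (y' - z) \<bullet> (x - z)" using nonneg e by blast
  also have "(y' - z) \<bullet> (x - z) =
      (y - z) \<bullet> (x - z) - (e / (2 * norm (x - z))) * ((x - z) \<bullet> (x - z))"
    by (simp only: y'_def inner_diff_left inner_scaleR_left)
  finally show ?thesis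
    using e \<open>x \<noteq> z\<close> by (smt (verit) divide_pos_pos inner_gt_zero_iff mult_pos_pos
        right_minus_eq zero_less_norm_iff)
qed

lemma INF_frontier_le:
  fixes G :: "'a::euclidean_space set"
  assumes "z \<in> frontier G"
  shows "(INF z\<in>frontier G. dist x z + dist z y) \<le> dist x z + dist z y"
  using assms by (intro cINF_lower) (auto intro!: bdd_belowI2[of _ 0])

lemma INF_frontier_commute:
  fixes G :: "'a::euclidean_space set"
  shows "(INF z\<in>frontier G. dist x z + dist z y) = (INF z\<in>frontier G. dist y z + dist z x)"
  by (simp add: dist_commute add.commute)

text \<open>The segment from \<open>x\<close> to \<open>p\<close> crosses the frontier, and turning
  towards \<open>y\<close> already at the crossing is no longer.\<close>

lemma INF_frontier_le_outside:
  fixes G :: "'a::euclidean_space set"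
  assumes "x \<in> G" "p \<notin> G"
  shows "(INF z\<in>frontier G. dist x z + dist z y) \<le> dist x p + dist p y"
proof -
  obtain q where q: "q \<in> closed_segment x p" "q \<in> frontier G"
    using connected_Int_frontier[of "closed_segment x p" G] assms by auto
  then have "dist x p = dist x q + dist q p"
    by (metis between between_mem_segment)
  moreover have "dist q y \<le> dist q p + dist p y" by (rule dist_triangle)
  ultimately show ?thesis
    using INF_frontier_le[OF q(2), of x y] by linarith
qed

lemma INF_frontier_le_dist_tilde:
  fixes G :: "'a::euclidean_space set"
  assumes "open G" "convex G" "x \<in> G" "y \<in> G" "x' \<in> tilde_set G x"
  shows "(INF z\<in>frontier G. dist x z + dist z y) \<le> dist y x'"
proof -
  define z where "z = midpoint x x'"
  have z: "z \<in> frontier G" "dist x z = bdist G x"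
    using assms(5) by (auto simp: tilde_set_def z_def dist_midpoint)
  have x': "x' = 2 *\<^sub>R z - x"
    by (simp add: z_def midpoint_def)
  note supp = nearest_frontier_point_supports[OF assms(1-3) z]
  define a where "a = (y - z) \<bullet> (x - z)"
  define b where "b = (x - z) \<bullet> (x - z)"
  have ab: "a > 0" "b > 0" using supp assms by (auto simp: a_def b_def)
  \<comment> \<open>The heights of \<open>y\<close> and \<open>x'\<close> over the hyperplane are in
    the ratio \<open>a\<close> to \<open>-b\<close>, so this weight puts \<open>p\<close> on
    it.\<close>
  define p where "p = (1 - a / (a + b)) *\<^sub>R y + (a / (a + b)) *\<^sub>R x'"
  have "p \<in> closed_segment y x'"
    using ab by (auto simp: closed_segment_def p_def intro!: exI[of _ "a / (a + b)"])
  then have 1: "dist y x' = dist y p + dist p x'"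
    by (metis between between_mem_segment)
  have "p - z = (1 - a / (a + b)) *\<^sub>R (y - z) - (a / (a + b)) *\<^sub>R (x - z)"
    by (simp add: p_def x' algebra_simps scaleR_2)
  then have "(p - z) \<bullet> (x - z) = (1 - a / (a + b)) * a - (a / (a + b)) * b"
    by (simp add: inner_diff_left a_def b_def)
  also have "\<dots> = 0" using ab by (simp add: field_simps)
  finally have orth: "(p - z) \<bullet> (x - z) = 0" .
  \<comment> \<open>The strictness of \<open>supp\<close> is essential here: it excludes the
    hyperplane itself.\<close>
  then have "p \<notin> G" using supp by force
  have "dist p x' = norm ((p - z) + (x - z))"
    by (simp add: dist_norm x' scaleR_2 algebra_simps)
  also have "\<dots> = norm ((p - z) - (x - z))"
    using orth by (simp add: norm_eq inner_add_left inner_add_right inner_diff_left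
        inner_diff_right inner_commute algebra_simps)
  finally have "dist p x' = dist x p" by (simp add: dist_norm norm_minus_commute)
  then show ?thesis
    using INF_frontier_le_outside[OF \<open>x \<in> G\<close> \<open>p \<notin> G\<close>, of y] 1 by (simp add: dist_commute)
qed

text \<open>Keeps the default \<open>infdist y {} = 0\<close> out of the lower bound on the
  denominator of \<open>w_fun\<close>. The witness reflects \<open>x\<close> in a nearest boundary
  point, which exists because the frontier is closed.\<close>

lemma tilde_set_nonempty:
  fixes G :: "'a::euclidean_space set"
  assumes "frontier G \<noteq> {}"
  shows "tilde_set G x \<noteq> {}"
proof -
  obtain z where z: "z \<in> frontier G" "infdist x (frontier G) = dist x z"
    using infdist_attains_inf[OF frontier_closed assms, of x] by auto
  have "dist x (2 *\<^sub>R z - x) = 2 * dist x z"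
    by (simp add: dist_norm scaleR_2 flip: norm_scaleR[of 2, simplified])
       (simp add: algebra_simps scaleR_2)
  then have "2 *\<^sub>R z - x \<in> tilde_set G x"
    using z by (simp add: tilde_set_def bdist_def midpoint_def)
  then show ?thesis by blast
qed

lemma INF_frontier_le_infdist_tilde:
  fixes G :: "'a::euclidean_space set"
  assumes "open G" "convex G" "frontier G \<noteq> {}" "x \<in> G" "y \<in> G"
  shows "(INF z\<in>frontier G. dist x z + dist z y) \<le> infdist y (tilde_set G x)"
  using INF_frontier_le_dist_tilde[OF assms(1,2,4,5)] tilde_set_nonempty[OF assms(3)]
  by (auto simp: infdist_notempty intro!: cINF_greatest)

lemma infdist_tilde_le:
  fixes G :: "'a::euclidean_space set"
  assumes "frontier G \<noteq> {}"
  shows "infdist y (tilde_set G x) \<le> dist x y + 2 * bdist G x"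
proof -
  obtain x' where x': "x' \<in> tilde_set G x" using tilde_set_nonempty[OF assms] by blast
  then have "dist x x' = 2 * bdist G x" by (simp add: tilde_set_def)
  then show ?thesis
    using infdist_le[OF x', of y] dist_triangle[of y x' x] by (simp add: dist_commute)
qed

text \<open>Translating \<open>x\<close> and \<open>y\<close> by \<open>q - p\<close> stays in their
  balls, and \<open>q\<close> is the same convex combination of the translates as \<open>p\<close>
  is of \<open>x\<close> and \<open>y\<close>.\<close>

lemma ball_closed_segment_subset:
  fixes G :: "'a::real_normed_vector set"
  assumes "convex G" "ball x d \<subseteq> G" "ball y d \<subseteq> G" "p \<in> closed_segment x y"
  shows "ball p d \<subseteq> G"
proof
  fix q assume q: "q \<in> ball p d"
  obtain u where u: "0 \<le> u" "u \<le> 1" "p = (1 - u) *\<^sub>R x + u *\<^sub>R y"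
    using assms(4) by (auto simp: closed_segment_def)
  have "x + (q - p) \<in> G" "y + (q - p) \<in> G"
    using q assms(2,3) by (auto simp: subset_iff dist_norm norm_minus_commute)
  then have "(1 - u) *\<^sub>R (x + (q - p)) + u *\<^sub>R (y + (q - p)) \<in> G"
    using \<open>convex G\<close> u by (intro convexD) auto
  also have "(1 - u) *\<^sub>R (x + (q - p)) + u *\<^sub>R (y + (q - p)) = q"
    by (simp add: u(3) algebra_simps)
  finally show "q \<in> G" .
qed

text \<open>Stewart's theorem for the foot \<open>p\<close> of the bisector at \<open>z\<close> gives
  \<open>|z - p|^2 = a b (1 - t^2 / (a + b)^2)\<close> with \<open>a = |x - z|\<close>, \<open>b = |z - y|\<close>, \<open>t = |x - y|\<close>;
  then \<open>4 a b \<le> (a + b)^2\<close>.\<close>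

lemma dist_sum_ge_of_segment_far:
  fixes x y z :: "'a::real_inner"
  assumes "0 < d" and far: "\<And>p. p \<in> closed_segment x y \<Longrightarrow> d \<le> dist z p"
  shows "(dist x y)\<^sup>2 + 4 * d\<^sup>2 \<le> (dist x z + dist z y)\<^sup>2"
proof -
  define a b where "a = dist x z" and "b = dist z y"
  have "a > 0" "b > 0"
    using far[of x] far[of y] \<open>0 < d\<close> by (auto simp: a_def b_def dist_commute)
  define k where "k = a / (a + b)"
  have k: "0 \<le> k" "k \<le> 1" "1 - k = b / (a + b)"
    using \<open>a > 0\<close> \<open>b > 0\<close> by (auto simp: k_def field_simps)
  define p where "p = (1 - k) *\<^sub>R x + k *\<^sub>R y"
  have "p \<in> closed_segment x y" using k(1,2) by (auto simp: p_def closed_segment_def)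
  then have "d\<^sup>2 \<le> (dist z p)\<^sup>2" using far \<open>0 < d\<close> by (intro power_mono) auto
  also have "\<dots> = (1 - k) * a\<^sup>2 + k * b\<^sup>2 - k * (1 - k) * (dist x y)\<^sup>2"
    unfolding a_def b_def dist_norm power2_norm_eq_inner p_def
    by (simp add: inner_diff_left inner_diff_right inner_add_left inner_add_right
        inner_commute algebra_simps)
  also have "\<dots> = a * b * (1 - (dist x y)\<^sup>2 / (a + b)\<^sup>2)"
    unfolding k(3) unfolding k_def using \<open>a > 0\<close> \<open>b > 0\<close>
    by (simp add: divide_simps) (simp add: algebra_simps power2_eq_square)
  also have "\<dots> \<le> ((a + b)\<^sup>2 / 4) * (1 - (dist x y)\<^sup>2 / (a + b)\<^sup>2)"
  proof (rule mult_right_mono)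
    show "a * b \<le> (a + b)\<^sup>2 / 4"
      using zero_le_power2[of "a - b"] by (simp add: power2_eq_square algebra_simps)
    have "(dist x y)\<^sup>2 \<le> (a + b)\<^sup>2"
      unfolding a_def b_def by (intro power_mono dist_triangle) auto
    then show "0 \<le> 1 - (dist x y)\<^sup>2 / (a + b)\<^sup>2"
      using \<open>a > 0\<close> \<open>b > 0\<close> by (simp add: divide_le_eq_1)
  qed
  also have "\<dots> = ((a + b)\<^sup>2 - (dist x y)\<^sup>2) / 4"
    using \<open>a > 0\<close> \<open>b > 0\<close> by (simp add: field_simps)
  finally show ?thesis by (simp add: a_def b_def)
qed

lemma bdist_pos:
  fixes G :: "'a::euclidean_space set"
  assumes "open G" "frontier G \<noteq> {}" "x \<in> G"
  shows "0 < bdist G x"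
  using assms in_closed_iff_infdist_zero[OF frontier_closed assms(2), of x]
    infdist_nonneg[of x "frontier G"]
  by (auto simp: bdist_def frontier_def interior_open less_le)

lemma sqrt_le_INF_frontier:
  fixes G :: "'a::euclidean_space set"
  assumes "open G" "convex G" "frontier G \<noteq> {}" "x \<in> G" "y \<in> G"
    and "0 < d" "d \<le> bdist G x" "d \<le> bdist G y"
  shows "sqrt ((dist x y)\<^sup>2 + 4 * d\<^sup>2) \<le> (INF z\<in>frontier G. dist x z + dist z y)"
proof (rule cINF_greatest)
  fix z assume "z \<in> frontier G"
  then have "z \<notin> G" using \<open>open G\<close> by (simp add: frontier_def interior_open)
  have "ball x d \<subseteq> G" "ball y d \<subseteq> G"
    using ball_bdist_subset[OF \<open>x \<in> G\<close>] ball_bdist_subset[OF \<open>y \<in> G\<close>] assms(7,8)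
    by (meson subset_ball subset_trans)+
  \<comment> \<open>Otherwise \<open>z\<close> would lie in \<open>ball p d\<close>, hence in
    \<open>G\<close>.\<close>
  then have "d \<le> dist z p" if "p \<in> closed_segment x y" for p
    using ball_closed_segment_subset[OF \<open>convex G\<close> _ _ that] \<open>z \<notin> G\<close>
    by (metis dist_commute in_mono mem_ball not_le)
  then show "sqrt ((dist x y)\<^sup>2 + 4 * d\<^sup>2) \<le> dist x z + dist z y"
    using dist_sum_ge_of_segment_far[OF \<open>0 < d\<close>] by (intro real_le_lsqrt) auto
qed fact

theorem theorem4p7:
  fixes G :: "(real ^ 'n) set" and x y :: "real ^ 'n"
  assumes "domain G" and "convex G" and "G \<noteq> UNIV"
    and "x \<in> G" and "y \<in> G"
  shows "w_fun G x y \<le> triangular_ratio_metric G x y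
    \<and> triangular_ratio_metric G x y \<le> sqrt 2 * w_fun G x y"
proof -
  have G: "open G" "frontier G \<noteq> {}"
    using assms by (auto simp: domain_def frontier_eq_empty)
  define S where "S = (INF z\<in>frontier G. dist x z + dist z y)"
  define M where "M = min (infdist x (tilde_set G y)) (infdist y (tilde_set G x))"
  define t where "t = dist x y"
  define d where "d = min (bdist G x) (bdist G y)"
  have d: "0 < d" "d \<le> bdist G x" "d \<le> bdist G y"
    using bdist_pos[OF G] assms by (auto simp: d_def)
  have lower: "sqrt (t\<^sup>2 + 4 * d\<^sup>2) \<le> S"
    unfolding S_def t_def using sqrt_le_INF_frontier[OF G(1) assms(2) G(2) assms(4,5) d] .
  have "0 < sqrt (t\<^sup>2 + 4 * d\<^sup>2)" using d(1) by (simp add: add_nonneg_pos)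
  with lower have "0 < S" by linarith
  have SM: "S \<le> M"
    unfolding S_def M_def
    using INF_frontier_le_infdist_tilde[OF G(1) assms(2) G(2) assms(4,5)]
      INF_frontier_le_infdist_tilde[OF G(1) assms(2) G(2) assms(5,4)]
    by (simp add: INF_frontier_commute[of x y G])
  \<comment> \<open>As \<open>M\<close> is a minimum, it may be bounded through whichever point is
    nearer to the boundary.\<close>
  have "M \<le> t + 2 * d"
    using infdist_tilde_le[OF G(2), of y x] infdist_tilde_le[OF G(2), of x y]
    by (auto simp: M_def t_def d_def min_def dist_commute)
  also have "\<dots> \<le> sqrt (2 * (t\<^sup>2 + 4 * d\<^sup>2))"
    using zero_le_power2[of "t - 2 * d"]
    by (intro real_le_rsqrt) (simp add: power2_eq_square algebra_simps)
  also have "\<dots> \<le> sqrt 2 * S"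
    unfolding real_sqrt_mult using lower by (intro mult_left_mono) auto
  finally have MS: "M \<le> sqrt 2 * S" .
  have "t / M \<le> t / S"
    using \<open>0 < S\<close> SM by (intro divide_left_mono) (auto simp: t_def)
  moreover have "t / S \<le> sqrt 2 * (t / M)"
  proof -
    have "t * M \<le> t * (sqrt 2 * S)" by (intro mult_left_mono MS) (simp add: t_def)
    then show ?thesis using \<open>0 < S\<close> SM by (simp add: field_simps)
  qed
  ultimately show ?thesis
    by (simp add: w_fun_def triangular_ratio_metric_def S_def M_def t_def)
qed

end
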